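(* Let $n\ge 3$, let $\mathbb{M}^n$ be a Cartan-Hadamard model manifold associated to a function $\psi$, and let $p,q>0$ satisfy $\frac{1}{p+1}+\frac{1}{q+1}\le\frac{n-2}{n}$. Suppose that, for some $(\xi,\eta)\in(0,+\infty)^2$, there exists a radial solution $(u,v)$ of the Lane-Emden system $-\Delta u=v^q$, $-\Delta v=u^p$, $u,v>0$ on $\mathbb{M}^n$ (that is, a globally positive solution of $CP(\xi,\eta)$) such that $$\int_0^{+\infty}u'v'\,\psi^{n-1}\,ds<+\infty\quad\text{or}\quad\int_0^{+\infty}u^{p+1}\,\psi^{n-1}\,ds<+\infty\quad\text{or}\quad\int_0^{+\infty}v^{q+1}\,\psi^{n-1}\,ds<+\infty.$$ Then $\mathbb{M}^n$ is isometric to $\mathbb{R}^n$ (i.e. $\psi(r)=r$ for all $r\ge0$), $\frac{1}{p+1}+\frac{1}{q+1}=\frac{n-2}{n}$, and $$\int_0^{+\infty}u'v'\,\psi^{n-1}\,ds+\int_0^{+\infty}u^{p+1}\,\psi^{n-1}\,ds+\int_0^{+\infty}v^{q+1}\,\psi^{n-1}\,ds<+\infty.$$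
   Context: A (noncompact) model manifold $\mathbb{M}^n$ associated to $\psi$ is a Riemannian manifold whose metric, in global polar coordinates $(r,\vartheta)\in\mathbb{R}^+\times\mathbb{S}^{n-1}$ about a pole $o$, is $g=dr\otimes dr+\psi^2(r)\,g_{\mathbb{S}^{n-1}}$, where $\psi\in C^1([0,+\infty))\cap C^\infty((0,+\infty))$, $\psi>0$ on $(0,+\infty)$, $\psi(0)=0$, $\psi'(0)=1$. It is Cartan-Hadamard if and only if $\psi$ is in addition convex. For $(\xi,\eta)\in(0,+\infty)^2$, $CP(\xi,\eta)$ denotes the Cauchy problem for functions $u,v$ of $r$ (of class $C^1$ up to $r=0$ and $C^2$ for $r>0$) $$(\psi^{n-1}u')'+\psi^{n-1}|v|^{q-1}v=0,\quad (\psi^{n-1}v')'+\psi^{n-1}|u|^{p-1}u=0\ \ (r>0),\quad u'(0)=v'(0)=0,\ u(0)=\xi,\ v(0)=\eta.$$ A globally positive solution is a solution defined for every $r>0$ with $u,v>0$ on $[0,+\infty)$. *)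

theory Defs
  imports "HOL-Analysis.Analysis"
begin

text \<open>
  Functions of the radial variable are total functions on the reals of which only the values on
  \<open>[0, \<infinity>)\<close> matter: at \<open>0\<close> all derivatives are one-sided, and \<^const>\<open>deriv\<close> (which is
  two-sided) is only ever evaluated at positive radii.
\<close>

definition C1_halfline :: "(real \<Rightarrow> real) \<Rightarrow> bool" where
  "C1_halfline f \<longleftrightarrow>
     (\<exists>f'. (\<forall>r\<ge>0. (f has_real_derivative f' r) (at r within {0..})) \<and> continuous_on {0..} f')"

definition model_function :: "(real \<Rightarrow> real) \<Rightarrow> bool" where
  "model_function \<psi> \<longleftrightarrow>
     C1_halfline \<psi> \<and>
     (\<forall>k. (deriv ^^ k) \<psi> differentiable_on {0<..}) \<and>
     (\<forall>r>0. \<psi> r > 0) \<and> \<psi> 0 = 0 \<and> (\<psi> has_real_derivative 1) (at 0 within {0..})"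

text \<open>
  The model manifold with metric \<open>dr\<^sup>2 + \<psi>(r)\<^sup>2 g\<close> is represented by \<open>\<psi>\<close>; it is
  Cartan-Hadamard iff \<open>\<psi>\<close> is convex, and it is Euclidean space iff \<open>\<psi>(r) = r\<close> for \<open>r \<ge> 0\<close>.
\<close>

definition Cartan_Hadamard_model :: "(real \<Rightarrow> real) \<Rightarrow> bool" where
  "Cartan_Hadamard_model \<psi> \<longleftrightarrow> model_function \<psi> \<and> convex_on {0..} \<psi>"

text \<open>
  Solutions of \<open>CP(\<xi>,\<eta>)\<close> that are defined for all \<open>r > 0\<close>.  At a zero of \<open>v\<close> the nonlinearity
  \<open>|v|\<^sup>q\<^sup>-\<^sup>1v\<close> evaluates to \<open>0\<close>, its continuous extension, also when \<open>q < 1\<close>.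
\<close>

definition global_solution_CP ::
  "nat \<Rightarrow> (real \<Rightarrow> real) \<Rightarrow> real \<Rightarrow> real \<Rightarrow> real \<Rightarrow> real \<Rightarrow> (real \<Rightarrow> real) \<Rightarrow> (real \<Rightarrow> real) \<Rightarrow> bool" where
  "global_solution_CP n \<psi> p q \<xi> \<eta> u v \<longleftrightarrow>
     C1_halfline u \<and> C1_halfline v \<and>
     u C1_differentiable_on {0<..} \<and> deriv u C1_differentiable_on {0<..} \<and>
     v C1_differentiable_on {0<..} \<and> deriv v C1_differentiable_on {0<..} \<and>
     (\<forall>r>0. deriv (\<lambda>s. \<psi> s ^ (n - 1) * deriv u s) r
              + \<psi> r ^ (n - 1) * (\<bar>v r\<bar> powr (q - 1) * v r) = 0) \<and>
     (\<forall>r>0. deriv (\<lambda>s. \<psi> s ^ (n - 1) * deriv v s) r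
              + \<psi> r ^ (n - 1) * (\<bar>u r\<bar> powr (p - 1) * u r) = 0) \<and>
     (u has_real_derivative 0) (at 0 within {0..}) \<and>
     (v has_real_derivative 0) (at 0 within {0..}) \<and>
     u 0 = \<xi> \<and> v 0 = \<eta>"

definition globally_positive_solution_CP ::
  "nat \<Rightarrow> (real \<Rightarrow> real) \<Rightarrow> real \<Rightarrow> real \<Rightarrow> real \<Rightarrow> real \<Rightarrow> (real \<Rightarrow> real) \<Rightarrow> (real \<Rightarrow> real) \<Rightarrow> bool" where
  "globally_positive_solution_CP n \<psi> p q \<xi> \<eta> u v \<longleftrightarrow>
     global_solution_CP n \<psi> p q \<xi> \<eta> u v \<and> (\<forall>r\<ge>0. u r > 0 \<and> v r > 0)"

text \<open>
  The integrals are \<open>[0, \<infinity>]\<close>-valued Lebesgue integrals.  \<^const>\<open>ennreal\<close> truncates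
  negative values to \<open>0\<close>; this loses nothing because \<open>u'v' \<psi>\<^sup>n\<^sup>-\<^sup>1\<close> is nonnegative
  for the solutions considered (lemma \<open>energy_integrand_nonneg\<close> below).
\<close>

definition energy_integral ::
  "nat \<Rightarrow> (real \<Rightarrow> real) \<Rightarrow> (real \<Rightarrow> real) \<Rightarrow> (real \<Rightarrow> real) \<Rightarrow> ennreal" where
  "energy_integral n \<psi> u v =
     (\<integral>\<^sup>+ s \<in> {0<..}. ennreal (deriv u s * deriv v s * \<psi> s ^ (n - 1)) \<partial>lborel)"

definition power_integral ::
  "nat \<Rightarrow> (real \<Rightarrow> real) \<Rightarrow> real \<Rightarrow> (real \<Rightarrow> real) \<Rightarrow> ennreal" where
  "power_integral n \<psi> a w =
     (\<integral>\<^sup>+ s \<in> {0<..}. ennreal (w s powr a * \<psi> s ^ (n - 1)) \<partial>lborel)"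

lemma C1_differentiable_has_deriv:
  fixes f :: "real \<Rightarrow> real"
  assumes "f C1_differentiable_on S" "x \<in> S"
  shows "(f has_real_derivative deriv f x) (at x)"
proof -
  obtain D where "(f has_vector_derivative D) (at x)"
    using assms unfolding C1_differentiable_on_def by blast
  then have "(f has_real_derivative D) (at x)"
    by (simp add: has_real_derivative_iff_has_vector_derivative)
  then show ?thesis
    by (simp add: DERIV_imp_deriv)
qed

lemma deriv_nonpos_of_flux:
  fixes \<psi> w g :: "real \<Rightarrow> real"
  assumes \<psi>: "model_function \<psi>" and n: "n \<ge> 2"
    and w0: "C1_halfline w"
    and w1: "w C1_differentiable_on {0<..}" and w2: "deriv w C1_differentiable_on {0<..}"
    and eq: "\<And>r. r > 0 \<Longrightarrow> deriv (\<lambda>s. \<psi> s ^ (n - 1) * deriv w s) r + \<psi> r ^ (n - 1) * g r = 0"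
    and g: "\<And>r. r > 0 \<Longrightarrow> g r \<ge> 0" and r: "r > 0"
  shows "deriv w r \<le> 0"
proof -
  obtain w' where w': "\<And>s. s \<ge> 0 \<Longrightarrow> (w has_real_derivative w' s) (at s within {0..})"
    and cw: "continuous_on {0..} w'"
    using w0 unfolding C1_halfline_def by blast
  have pos: "\<And>s. s > 0 \<Longrightarrow> \<psi> s > 0" and z: "\<psi> 0 = 0"
    using \<psi> unfolding model_function_def by auto
  have c\<psi>: "continuous_on {0..} \<psi>"
    using \<psi> unfolding model_function_def C1_halfline_def
    by (auto simp: continuous_on_eq_continuous_within intro: DERIV_continuous)
  have eqd: "w' s = deriv w s" if "s > 0" for s
  proof -
    have "at s within {0..} = at s"
      using that by (intro at_within_open_subset[where S = "{0<..}"]) auto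
    then show ?thesis
      using w'[of s] that by (simp add: DERIV_imp_deriv)
  qed
  let ?W = "\<lambda>s. \<psi> s ^ (n - 1) * w' s"
  have "?W r \<le> ?W 0"
  proof (rule DERIV_nonpos_imp_decreasing_open[where f = ?W])
    fix x assume x: "0 < x" "x < r"
    have d\<psi>: "(\<psi> has_real_derivative deriv \<psi> x) (at x)"
    proof -
      have "(deriv ^^ 0) \<psi> differentiable_on {0<..}"
        using \<psi> unfolding model_function_def by blast
      then have "\<psi> differentiable at x within {0<..}"
        using x unfolding differentiable_on_def by simp
      moreover have "at x within {0<..} = at x"
        using x by (intro at_within_open) auto
      ultimately have "\<psi> differentiable at x"
        by simp
      then show ?thesis
        by (simp add: DERIV_deriv_iff_real_differentiable)
    qed
    have "(deriv w has_real_derivative deriv (deriv w) x) (at x)"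
      using C1_differentiable_has_deriv[OF w2] x by simp
    then obtain D where D: "((\<lambda>s. \<psi> s ^ (n - 1) * deriv w s) has_real_derivative D) (at x)"
      using DERIV_mult[OF DERIV_power[OF d\<psi>]] by blast
    moreover have "D = - (\<psi> x ^ (n - 1) * g x)"
      using eq[OF x(1)] DERIV_imp_deriv[OF D] by linarith
    ultimately have "((\<lambda>s. \<psi> s ^ (n - 1) * deriv w s) has_real_derivative
                 - (\<psi> x ^ (n - 1) * g x)) (at x)"
      by simp
    then have "(?W has_real_derivative - (\<psi> x ^ (n - 1) * g x)) (at x)"
      by (rule has_field_derivative_transform_within_open[where S = "{0<..}"])
        (use x eqd in auto)
    moreover have "- (\<psi> x ^ (n - 1) * g x) \<le> 0"
      using mult_nonneg_nonneg[OF zero_le_power[OF less_imp_le[OF pos[OF x(1)]]] g[OF x(1)]]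
      by simp
    ultimately show "\<exists>y. (?W has_real_derivative y) (at x) \<and> y \<le> 0"
      by blast
  next
    show "continuous_on {0..r} ?W"
      by (intro continuous_on_mult continuous_on_power
          continuous_on_subset[OF c\<psi>] continuous_on_subset[OF cw]) auto
  qed (use r in simp)
  moreover have "?W 0 = 0"
    using z n by simp
  ultimately have "\<psi> r ^ (n - 1) * w' r \<le> 0"
    by (simp only:)
  then have "w' r \<le> 0"
    using zero_less_power[OF pos[OF r], of "n - 1"] by (auto simp: mult_le_0_iff)
  then show ?thesis
    using eqd[OF r] by simp
qed

lemma energy_integrand_nonneg:
  assumes \<psi>: "model_function \<psi>" and n: "n \<ge> 2"
    and uv: "globally_positive_solution_CP n \<psi> p q \<xi> \<eta> u v" and s: "s > 0"
  shows "deriv u s * deriv v s * \<psi> s ^ (n - 1) \<ge> 0"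
proof -
  have pos: "\<And>r. r > 0 \<Longrightarrow> u r > 0 \<and> v r > 0"
    using uv unfolding globally_positive_solution_CP_def by simp
  have "deriv u s \<le> 0"
    using uv pos unfolding globally_positive_solution_CP_def global_solution_CP_def
    by (intro deriv_nonpos_of_flux[OF \<psi> n, where g = "\<lambda>r. \<bar>v r\<bar> powr (q - 1) * v r"])
      (auto simp: s less_imp_le)
  moreover have "deriv v s \<le> 0"
    using uv pos unfolding globally_positive_solution_CP_def global_solution_CP_def
    by (intro deriv_nonpos_of_flux[OF \<psi> n, where g = "\<lambda>r. \<bar>u r\<bar> powr (p - 1) * u r"])
      (auto simp: s less_imp_le)
  moreover have "\<psi> s > 0"
    using \<psi> s unfolding model_function_def by simp
  ultimately show ?thesis
    by (simp add: mult_nonpos_nonpos)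
qed

end

theory Submission
  imports Defs
begin

text \<open>
  Write \<open>W = \<psi>\<^sup>n\<^sup>-\<^sup>1\<close>, \<open>V(r) = \<integral>\<^sub>0\<^sup>r W\<close>, \<open>F(r) = \<integral>\<^sub>0\<^sup>r W u' v'\<close>,
  \<open>a = 1/(p+1)\<close> and \<open>b = 1/(q+1)\<close>. The Pohozaev functional
  \<open>P = V (u'v' + a u\<^sup>p\<^sup>+\<^sup>1 + b v\<^sup>q\<^sup>+\<^sup>1) + W (a u v' + b u' v)\<close> satisfies
  \<open>P' = W u'v' (1 + a + b - 2 V W' / W\<^sup>2)\<close>. Convexity of \<open>\<psi>\<close> gives \<open>V W' / W\<^sup>2 \<ge> (n-1)/n\<close>, so \<open>P\<close>
  is nonincreasing from \<open>P(0) = 0\<close>. The fluxes \<open>-W u'\<close>, \<open>-W v'\<close> are increasing, and if \<open>F\<close> is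
  bounded then \<open>u\<close>, \<open>v\<close> and the boundary terms \<open>W u v'\<close>, \<open>W u' v\<close> tend to \<open>0\<close>. As the first summand
  of \<open>P\<close> is nonnegative, this forces \<open>P = 0\<close>, hence equality in both inequalities, and equality in the
  volume comparison makes \<open>\<psi>'\<close> constant. Finally \<open>\<integral>\<^sub>0\<^sup>r W u\<^sup>p\<^sup>+\<^sup>1 = F(r) - W(r) u(r) v'(r)\<close>, so the
  three integrals are finite simultaneously.
\<close>

section \<open>Calculus on the half-line\<close>

lemma nondecreasing_halfline:
  fixes f f' :: "real \<Rightarrow> real"
  assumes "continuous_on {a..} f"
    and "\<And>x. x > a \<Longrightarrow> (f has_real_derivative f' x) (at x)"
    and "\<And>x. x > a \<Longrightarrow> f' x \<ge> 0"
    and "a \<le> x" "x \<le> y"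
  shows "f x \<le> f y"
proof (rule DERIV_nonneg_imp_increasing_open[OF \<open>x \<le> y\<close>])
  show "continuous_on {x..y} f"
    by (rule continuous_on_subset[OF assms(1)]) (use assms in auto)
  show "\<exists>d. (f has_real_derivative d) (at z) \<and> d \<ge> 0" if "x < z" "z < y" for z
    using assms(2,3)[of z] assms(4) that by force
qed

lemma increasing_halfline:
  fixes f f' :: "real \<Rightarrow> real"
  assumes "continuous_on {a..} f"
    and "\<And>x. x > a \<Longrightarrow> (f has_real_derivative f' x) (at x)"
    and "\<And>x. x > a \<Longrightarrow> f' x > 0"
    and "a \<le> x" "x < y"
  shows "f x < f y"
proof (rule DERIV_pos_imp_increasing_open[OF \<open>x < y\<close>])
  show "continuous_on {x..y} f"
    by (rule continuous_on_subset[OF assms(1)]) (use assms in auto)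
  show "\<exists>d. (f has_real_derivative d) (at z) \<and> d > 0" if "x < z" "z < y" for z
    using assms(2,3)[of z] assms(4) that by force
qed

lemma antiderivative_halfline:
  fixes f :: "real \<Rightarrow> real"
  assumes "continuous_on {0..} f"
  obtains F where "continuous_on {0..} F" "F 0 = 0"
    "\<And>r. r > 0 \<Longrightarrow> (F has_real_derivative f r) (at r)"
proof -
  \<comment> \<open>Freezing \<open>f\<close> at its value at \<open>0\<close> for negative
    arguments extends it continuously to the whole line, so that an antiderivative with infinite
    endpoints can be used.\<close>
  have "continuous_on UNIV (\<lambda>x. f (max 0 x))"
    by (rule continuous_on_compose2[OF assms]) (auto intro!: continuous_intros)
  then have "\<exists>G. \<forall>x::real. -\<infinity> < ereal x \<longrightarrow> ereal x < \<infinity> \<longrightarrow> (G has_vector_derivative f (max 0 x)) (at x)"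
    by (intro einterval_antiderivative) (auto simp: continuous_on_eq_continuous_at)
  then obtain G where G: "\<And>x. (G has_real_derivative f (max 0 x)) (at x)"
    by (auto simp: has_real_derivative_iff_has_vector_derivative)
  show ?thesis
  proof
    show "continuous_on {0..} (\<lambda>x. G x - G 0)"
      by (intro continuous_intros continuous_at_imp_continuous_on ballI DERIV_isCont[OF G])
    show "((\<lambda>x. G x - G 0) has_real_derivative f r) (at r)" if "r > 0" for r
      using G[of r] that by (auto intro!: derivative_eq_intros)
  qed simp
qed

text \<open>Since \<open>f\<close> is nonnegative, \<open>F\<close> is nondecreasing and the
  integral can only be the supremum of \<open>F\<close>. Nothing is assumed on \<open>f\<close> near
  \<open>0\<close>, so one direction works on \<open>[x, y]\<close> with \<open>x > 0\<close> and
  lets \<open>x\<close> tend to \<open>0\<close>; the other uses the limits of \<open>F\<close> at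
  both ends.\<close>

lemma nn_integral_halfline_finite_iff:
  fixes f F :: "real \<Rightarrow> real"
  assumes F: "continuous_on {0..} F" "F 0 = 0"
    and F': "\<And>r. r > 0 \<Longrightarrow> (F has_real_derivative f r) (at r)"
    and f: "continuous_on {0<..} f" "\<And>r. r > 0 \<Longrightarrow> f r \<ge> 0"
  shows "(\<integral>\<^sup>+ s \<in> {0<..}. ennreal (f s) \<partial>lborel) < \<infinity> \<longleftrightarrow> bdd_above (F ` {0..})"
proof
  have mono: "F x \<le> F y" if "0 \<le> x" "x \<le> y" for x y
    using nondecreasing_halfline[OF F(1) F' f(2) that] by simp
  have F0: "(F \<longlongrightarrow> 0) (at_right 0)"
    using F by (auto simp: continuous_on_def at_within_Ici_at_right dest!: bspec[where x = 0])
  {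
    assume fin: "(\<integral>\<^sup>+ s \<in> {0<..}. ennreal (f s) \<partial>lborel) < \<infinity>"
    define I where "I = enn2real (\<integral>\<^sup>+ s \<in> {0<..}. ennreal (f s) \<partial>lborel)"
    have "F y - F x \<le> I" if xy: "0 < x" "x \<le> y" for x y
    proof -
      \<comment> \<open>\<open>f\<close> is continuous only on the open half-line; \<open>?g\<close>
        is continuous, hence measurable, on the whole line and agrees with \<open>f\<close> on
        \<open>[x, y]\<close>.\<close>
      let ?g = "\<lambda>s. f (max x s)"
      have "continuous_on UNIV ?g"
        by (rule continuous_on_compose2[OF f(1)]) (use xy in \<open>auto intro!: continuous_intros\<close>)
      then have "?g \<in> borel_measurable borel"
        by (rule borel_measurable_continuous_onI)
      then have "(\<integral>\<^sup>+ s. ennreal (?g s) * indicator {x..y} s \<partial>lborel) = F y - F x"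
        using xy by (intro nn_integral_FTC_Icc) (auto intro!: DERIV_subset[OF F'] f(2) simp: max_def)
      moreover have "(\<integral>\<^sup>+ s. ennreal (?g s) * indicator {x..y} s \<partial>lborel)
          \<le> (\<integral>\<^sup>+ s \<in> {0<..}. ennreal (f s) \<partial>lborel)"
        using xy by (intro nn_integral_mono) (auto simp: indicator_def max_def)
      ultimately have "ennreal (F y - F x) \<le> ennreal I"
        using fin by (simp add: I_def)
      then show ?thesis
        using mono[of x y] xy by (auto simp: I_def ennreal_le_iff)
    qed
    then have "F y \<le> I" if "y > 0" for y
      using that F0
      by (intro tendsto_lowerbound[of "\<lambda>x. I + F x" I "at_right 0"])
        (auto intro!: tendsto_eq_intros eventually_at_rightI[of 0 y] simp: add.commute diff_le_eq)
    moreover have "I \<ge> 0"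
      by (simp add: I_def)
    ultimately show "bdd_above (F ` {0..})"
      using F(2) by (intro bdd_aboveI2[where M = I]) (metis atLeast_iff le_less)
  }
  assume bdd: "bdd_above (F ` {0..})"
  define L where "L = (SUP r\<in>{0..}. F r)"
  have lim: "(F \<longlongrightarrow> L) at_top"
  proof (rule order_tendstoI)
    fix a assume "a < L"
    then obtain r where r: "r \<ge> 0" "a < F r"
      unfolding L_def using less_cSUP_iff[OF _ bdd] by auto
    show "eventually (\<lambda>x. a < F x) at_top"
      using eventually_ge_at_top[of r] by eventually_elim (use mono r in force)
  next
    fix a assume "L < a"
    moreover have "F x \<le> L" if "x \<ge> 0" for x
      unfolding L_def by (intro cSUP_upper bdd) (use that in simp)
    ultimately show "eventually (\<lambda>x. F x < a) at_top"
      by (intro eventually_at_top_linorderI[of 0]) force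
  qed
  have "set_integrable lborel (einterval 0 \<infinity>) f"
  proof (rule interval_integral_FTC_nonneg)
    show "((F \<circ> real_of_ereal) \<longlongrightarrow> 0) (at_right 0)"
      using F0 by (simp add: ereal_tendsto_simps zero_ereal_def)
    show "((F \<circ> real_of_ereal) \<longlongrightarrow> L) (at_left \<infinity>)"
      using lim by (simp add: ereal_tendsto_simps)
    show "isCont f x" if "0 < ereal x" for x
      using f(1) that by (simp add: continuous_on_eq_continuous_at)
  qed (use F' f in auto)
  then have "integrable lborel (\<lambda>s. indicator {0<..} s * f s)"
    by (simp add: set_integrable_def einterval_def greaterThan_def)
  then have "(\<integral>\<^sup>+ s. ennreal (norm (indicator {0<..} s * f s)) \<partial>lborel) < \<infinity>"
    by (simp add: integrable_iff_bounded)
  also have "(\<lambda>s. ennreal (norm (indicator {0<..} s * f s))) = (\<lambda>s. ennreal (f s) * indicator {0<..} s)"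
    using f(2) by (auto simp: indicator_def)
  finally show "(\<integral>\<^sup>+ s \<in> {0<..}. ennreal (f s) \<partial>lborel) < \<infinity>" .
qed


section \<open>Positive radial solutions\<close>

text \<open>
  \<open>u1\<close> and \<open>v1\<close> are the derivatives of \<open>u\<close> and \<open>v\<close>, extended continuously to \<open>0\<close>. The weight \<open>W\<close> is
  arbitrary; the assumptions are invariant under exchanging \<open>(u, p)\<close> and \<open>(v, q)\<close>.
\<close>

locale positive_radial_solution =
  fixes W V F u v u1 v1 :: "real \<Rightarrow> real" and p q :: real
  assumes W_cont: "continuous_on {0..} W" and W_0: "W 0 = 0" and W_pos: "r > 0 \<Longrightarrow> W r > 0"
    and V_cont: "continuous_on {0..} V" and V_0: "V 0 = 0"
    and V_deriv: "r > 0 \<Longrightarrow> (V has_real_derivative W r) (at r)"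
    and F_cont: "continuous_on {0..} F" and F_0: "F 0 = 0"
    and F_deriv: "r > 0 \<Longrightarrow> (F has_real_derivative W r * (u1 r * v1 r)) (at r)"
    and u_cont: "continuous_on {0..} u" and v_cont: "continuous_on {0..} v"
    and u1_cont: "continuous_on {0..} u1" and v1_cont: "continuous_on {0..} v1"
    and u_pos: "r \<ge> 0 \<Longrightarrow> u r > 0" and v_pos: "r \<ge> 0 \<Longrightarrow> v r > 0"
    and u_deriv: "r > 0 \<Longrightarrow> (u has_real_derivative u1 r) (at r)"
    and v_deriv: "r > 0 \<Longrightarrow> (v has_real_derivative v1 r) (at r)"
    and u_flux: "r > 0 \<Longrightarrow> ((\<lambda>s. W s * u1 s) has_real_derivative - (W r * v r powr q)) (at r)"
    and v_flux: "r > 0 \<Longrightarrow> ((\<lambda>s. W s * v1 s) has_real_derivative - (W r * u r powr p)) (at r)"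
    and p_pos: "p > 0" and q_pos: "q > 0"
begin

lemma swapped: "positive_radial_solution W V F v u v1 u1 q p"
  using W_cont W_0 W_pos V_cont V_0 V_deriv F_cont F_0 F_deriv u_cont v_cont u1_cont v1_cont
    u_pos v_pos u_deriv v_deriv u_flux v_flux p_pos q_pos
  by unfold_locales (auto simp: mult.commute)

section \<open>Signs and monotonicity\<close>

lemma v_flux_mono:
  assumes "0 \<le> r" "r \<le> s"
  shows "W s * v1 s \<le> W r * v1 r"
proof -
  have "- (W r * v1 r) \<le> - (W s * v1 s)"
  proof (rule nondecreasing_halfline[where a = 0 and f = "\<lambda>s. - (W s * v1 s)"])
    show "continuous_on {0..} (\<lambda>s. - (W s * v1 s))"
      by (intro continuous_intros W_cont v1_cont)
    show "((\<lambda>s. - (W s * v1 s)) has_real_derivative W x * u x powr p) (at x)" if "x > 0" for x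
      using DERIV_minus[OF v_flux[OF that]] by simp
  qed (use assms in \<open>simp_all add: less_imp_le[OF W_pos]\<close>)
  then show ?thesis
    by simp
qed

lemma v1_neg:
  assumes "r > 0"
  shows "v1 r < 0"
proof -
  have "- (W 0 * v1 0) < - (W r * v1 r)"
  proof (rule increasing_halfline[where a = 0 and f = "\<lambda>s. - (W s * v1 s)"])
    show "continuous_on {0..} (\<lambda>s. - (W s * v1 s))"
      by (intro continuous_intros W_cont v1_cont)
    show "((\<lambda>s. - (W s * v1 s)) has_real_derivative W x * u x powr p) (at x)" if "x > 0" for x
      using DERIV_minus[OF v_flux[OF that]] by simp
    show "W x * u x powr p > 0" if "x > 0" for x
      using that W_pos u_pos[of x] by simp
  qed (use assms in auto)
  then have "W r * v1 r < 0"
    by (simp add: W_0)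
  then show ?thesis
    using W_pos[OF assms] by (simp add: mult_less_0_iff)
qed

lemma u1_neg: "r > 0 \<Longrightarrow> u1 r < 0"
  by (rule positive_radial_solution.v1_neg[OF swapped])

lemma v_strict_decreasing:
  assumes "0 \<le> r" "r < s"
  shows "v s < v r"
proof -
  have "- v r < - v s"
  proof (rule increasing_halfline[where a = 0 and f = "\<lambda>s. - v s"])
    show "((\<lambda>s. - v s) has_real_derivative - v1 x) (at x)" if "x > 0" for x
      using DERIV_minus[OF v_deriv[OF that]] by simp
  qed (use assms v1_neg v_cont in \<open>auto intro!: continuous_intros\<close>)
  then show ?thesis
    by simp
qed

lemma v_decreasing: "0 \<le> r \<Longrightarrow> r \<le> s \<Longrightarrow> v s \<le> v r"
  using v_strict_decreasing[of r s] by (cases "r = s") auto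

lemma u_decreasing: "0 \<le> r \<Longrightarrow> r \<le> s \<Longrightarrow> u s \<le> u r"
  by (rule positive_radial_solution.v_decreasing[OF swapped])

lemma V_pos: "r > 0 \<Longrightarrow> V r > 0"
  using increasing_halfline[OF V_cont V_deriv W_pos, of 0 r] V_0 by simp

lemma F_mono:
  assumes "0 \<le> r" "r \<le> s"
  shows "F r \<le> F s"
proof (rule nondecreasing_halfline[OF F_cont F_deriv _ assms])
  show "W x * (u1 x * v1 x) \<ge> 0" if "x > 0" for x
    using that W_pos[of x] u1_neg[of x] v1_neg[of x] by (simp add: mult_nonpos_nonpos less_imp_le)
qed

section \<open>Flux estimates and decay at infinity\<close>

text \<open>The derivative of \<open>-W v1\<close> is \<open>W u^p\<close>, and \<open>u\<close> is
  decreasing, so \<open>u^p\<close> is at least its value at \<open>r\<close> on all of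
  \<open>[0, r]\<close>; integrate from \<open>0\<close>.\<close>

lemma volume_le_v_flux:
  assumes "r > 0"
  shows "V r * u r powr p \<le> - (W r * v1 r)"
proof -
  let ?g = "\<lambda>x. - (W x * v1 x) - V x * u r powr p"
  have "?g 0 \<le> ?g r"
  proof (rule DERIV_nonneg_imp_increasing_open[where f = ?g])
    fix x assume x: "0 < x" "x < r"
    have "(?g has_real_derivative W x * u x powr p - W x * u r powr p) (at x)"
      using DERIV_diff[OF DERIV_minus[OF v_flux] DERIV_cmult_right[OF V_deriv]] x by simp
    moreover have "u r powr p \<le> u x powr p"
      using x u_decreasing[of x r] u_pos[of r] p_pos by (intro powr_mono2) auto
    then have "W x * u r powr p \<le> W x * u x powr p"
      using W_pos[OF x(1)] by (intro mult_left_mono) auto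
    ultimately show "\<exists>d. (?g has_real_derivative d) (at x) \<and> d \<ge> 0"
      by force
  next
    show "continuous_on {0..r} ?g"
      by (rule continuous_on_subset[of "{0..}"])
        (auto intro!: continuous_intros W_cont v1_cont V_cont)
  qed (use assms in simp)
  then show ?thesis
    by (simp add: W_0 V_0)
qed

text \<open>The integrand of \<open>F\<close> is the product of \<open>-W v1\<close> and
  \<open>-u1\<close>. The first factor is nondecreasing, hence at least its value at
  \<open>r\<close> on \<open>[r, s]\<close>, and the second integrates to
  \<open>u r - u s\<close>.\<close>

lemma flux_oscillation:
  assumes "0 < r" "r \<le> s"
  shows "- (W r * v1 r) * (u r - u s) \<le> F s - F r"
proof -
  let ?g = "\<lambda>x. F x - W r * v1 r * u x"
  have "?g r \<le> ?g s"
  proof (rule nondecreasing_halfline[OF _ _ _ order_refl assms(2)])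
    show "continuous_on {r..} ?g"
      by (rule continuous_on_subset[of "{0..}"])
        (use assms in \<open>auto intro!: continuous_intros F_cont u_cont\<close>)
    show "(?g has_real_derivative u1 x * (W x * v1 x - W r * v1 r)) (at x)" if "x > r" for x
      using that assms by (auto intro!: derivative_eq_intros F_deriv u_deriv simp: algebra_simps)
    show "u1 x * (W x * v1 x - W r * v1 r) \<ge> 0" if "x > r" for x
      using that assms u1_neg[of x] v_flux_mono[of r x] by (intro mult_nonpos_nonpos) auto
  qed
  then show ?thesis
    by (simp add: algebra_simps)
qed

text \<open>
  If \<open>u \<ge> c > 0\<close>, then \<open>-v' \<ge> c\<^sup>p V / W\<close>. Let \<open>w = v - inf v\<close>. Boundedness of \<open>F\<close> yields
  \<open>V w\<^sup>q\<^sup>+\<^sup>1 \<le> E\<close>, hence with \<open>m = 1/(2(q+1))\<close> and \<open>X = V\<^sup>1\<^sup>+\<^sup>m / W\<close> the derivative of a multiple of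
  \<open>-sqrt w\<close> is at least \<open>X/2\<close>, while that of \<open>-V\<^sup>-\<^sup>m/(2m)\<close> is \<open>1/(2X)\<close>. As \<open>X/2 + 1/(2X) \<ge> 1\<close>,
  the function \<open>?G\<close> below is nonincreasing although \<open>?G r \<ge> r\<close>.
\<close>

lemma u_tends_to_zero:
  assumes bdd: "bdd_above (F ` {0..})" and c: "c > 0"
  shows "\<exists>r\<ge>0. u r < c"
proof (rule ccontr)
  interpret swap: positive_radial_solution W V F v u v1 u1 q p
    by (rule swapped)
  assume "\<not> ?thesis"
  then have u_ge: "u r \<ge> c" if "r \<ge> 0" for r
    using that by (auto simp: not_less)
  define d where "d = (INF r\<in>{0..}. v r)"
  define w where "w = (\<lambda>r. v r - d)"
  define E where "E = (SUP r\<in>{0..}. F r)"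
  have v_bdd: "bdd_below (v ` {0..})"
    using v_pos by (intro bdd_belowI2[where m = 0]) (auto intro: less_imp_le)
  have d_le: "d \<le> v r" if "r \<ge> 0" for r
    unfolding d_def by (intro cINF_lower v_bdd) (use that in simp)
  have d_nonneg: "d \<ge> 0"
    unfolding d_def using v_pos by (intro cINF_greatest) (auto intro: less_imp_le)
  have F_le: "F r \<le> E" if "r \<ge> 0" for r
    unfolding E_def by (intro cSUP_upper bdd) (use that in simp)
  \<comment> \<open>Strict monotonicity prevents \<open>v\<close> from attaining its infimum; this
    makes \<open>sqrt w\<close> differentiable below.\<close>
  have w_pos: "w r > 0" if "r \<ge> 0" for r
    using d_le[of "r + 1"] v_strict_decreasing[of r "r + 1"] that by (simp add: w_def)
  \<comment> \<open>With \<open>B\<close> the flux of \<open>u\<close> at \<open>r\<close>, the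
    oscillation estimate for \<open>v\<close> bounds \<open>B (v r - v s)\<close> by
    \<open>E\<close> for \<open>s \<ge> r\<close>; passing to the infimum over \<open>s\<close>
    gives \<open>B w \<le> E\<close>. The volume estimate gives
    \<open>B \<ge> V v^q \<ge> V w^q\<close>.\<close>
  have w_bound: "V r * w r powr (q + 1) \<le> E" if r: "r > 0" for r
  proof -
    define B where "B = - (W r * u1 r)"
    have B: "B > 0"
      using W_pos[OF r] u1_neg[OF r] by (simp add: B_def mult_less_0_iff)
    have "v r - E / B \<le> v s" if "s \<ge> 0" for s
    proof (cases "s \<ge> r")
      case True
      have "B * (v r - v s) \<le> E"
        using swap.flux_oscillation[OF r True] F_le[OF that] F_mono[of 0 r] r F_0
        by (simp add: B_def)
      then show ?thesis
        using B by (simp add: field_simps)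
    next
      case False
      have "E \<ge> 0"
        using F_le[of 0] F_0 by simp
      then show ?thesis
        using v_decreasing[of s r] that False B by (simp add: add_increasing2 diff_le_eq)
    qed
    then have "v r - E / B \<le> d"
      unfolding d_def by (intro cINF_greatest) auto
    then have Bw: "B * w r \<le> E"
      using B by (simp add: w_def field_simps)
    have "V r * w r powr q \<le> V r * v r powr q"
      using V_pos[OF r] w_pos[of r] r d_nonneg q_pos
      by (intro mult_left_mono powr_mono2) (auto simp: w_def)
    also have "\<dots> \<le> B"
      using swap.volume_le_v_flux[OF r] by (simp add: B_def)
    finally have "V r * w r powr q * w r \<le> B * w r"
      using w_pos[of r] r by (intro mult_right_mono) auto
    also note Bw
    finally show ?thesis
      using w_pos[of r] r by (simp add: powr_add mult.assoc)
  qed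
  define m where "m = 1 / (2 * (q + 1))"
  define K where "K = E powr m"
  \<comment> \<open>The factor \<open>c powr p\<close> cancels the one in the lower bound
    \<open>-W v1 \<ge> c^p V\<close>, leaving \<open>K V\<close>, which dominates
    \<open>V^m sqrt w V\<close> by \<open>K_bound\<close> below.\<close>
  define C where "C = K / c powr p"
  have m: "m > 0"
    using q_pos by (simp add: m_def)
  have "V 1 * w 1 powr (q + 1) > 0"
    using V_pos[of 1] w_pos[of 1] by simp
  then have K: "K > 0"
    using w_bound[of 1] by (simp add: K_def)
  have C: "C \<ge> 0" "C * c powr p = K"
    using K c by (simp_all add: C_def)
  have K_bound: "V r powr m * sqrt (w r) \<le> K" if r: "r > 0" for r
  proof -
    have "(V r * w r powr (q + 1)) powr m \<le> K"
      unfolding K_def using w_bound[OF r] V_pos[OF r] m by (intro powr_mono2) auto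
    moreover have "(V r * w r powr (q + 1)) powr m = V r powr m * w r powr (1 / 2)"
    proof -
      have "(q + 1) * m = 1 / 2"
        using q_pos by (simp add: m_def)
      then show ?thesis
        using V_pos[OF r] by (simp only: powr_mult powr_powr)
    qed
    ultimately show ?thesis
      using w_pos[of r] r by (simp add: powr_half_sqrt)
  qed
  let ?G = "\<lambda>r. r + C * sqrt (w r) + V r powr (- m) / (2 * m)"
  \<comment> \<open>The comparison starts at radius \<open>1\<close> because
    \<open>V powr (- m)\<close> is singular at \<open>0\<close>, where \<open>V\<close>
    vanishes.\<close>
  have G: "- ?G 1 \<le> - ?G r" if "r \<ge> 1" for r
  proof (rule nondecreasing_halfline[OF _ _ _ order_refl that])
    let ?G' = "\<lambda>x. - (1 + C * (v1 x / (2 * sqrt (w x))) - V x powr (- m - 1) * W x / 2)"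
    show G': "((\<lambda>x. - ?G x) has_real_derivative ?G' x) (at x)" if "x > 1" for x
    proof -
      have dV: "((\<lambda>x. V x powr (- m)) has_real_derivative - m * V x powr (- m - of_nat 1) * W x) (at x)"
        using that by (intro DERIV_fun_powr V_deriv V_pos) auto
      have "(w has_real_derivative v1 x) (at x)"
        unfolding w_def using that by (auto intro!: derivative_eq_intros v_deriv)
      then have dw: "((\<lambda>x. sqrt (w x)) has_real_derivative v1 x / (2 * sqrt (w x))) (at x)"
        using w_pos[of x] that by (auto intro!: derivative_eq_intros simp: field_simps)
      show ?thesis
        by (rule DERIV_cong[OF DERIV_minus[OF DERIV_add[OF DERIV_add[OF DERIV_ident
                DERIV_cmult[OF dw, of C]] DERIV_cdivide[OF dV, of "2 * m"]]]])
          (use m in simp)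
    qed
    show "?G' x \<ge> 0" if x: "x > 1" for x
    proof -
      define X where "X = V x powr m * V x / W x"
      have pos: "V x > 0" "W x > 0" "sqrt (w x) > 0"
        using x V_pos[of x] W_pos[of x] w_pos[of x] by auto
      have X: "X > 0"
        using pos by (simp add: X_def)
      have X2: "V x powr (- m - 1) * W x = 1 / X"
        using pos by (simp add: X_def powr_diff powr_minus field_simps)
      have "c powr p * V x \<le> u x powr p * V x"
        using c u_ge[of x] x p_pos pos by (intro mult_right_mono powr_mono2) auto
      also have "\<dots> \<le> - (W x * v1 x)"
        using volume_le_v_flux[of x] x by (simp add: mult.commute)
      finally have "C * (c powr p * V x) \<le> C * (- (W x * v1 x))"
        by (rule mult_left_mono[OF _ C(1)])
      then have "K * V x \<le> - (C * W x * v1 x)"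
        by (simp add: C(2)[symmetric] algebra_simps)
      moreover have "V x powr m * sqrt (w x) * V x \<le> K * V x"
        using K_bound[of x] x pos by (intro mult_right_mono) auto
      ultimately have "V x powr m * sqrt (w x) * V x \<le> - (C * W x * v1 x)"
        by linarith
      then have "X / 2 \<le> - (C * (v1 x / (2 * sqrt (w x))))"
        using pos by (simp add: X_def field_simps)
      moreover have "1 \<le> X / 2 + 1 / X / 2"
        using X zero_le_power2[of "X - 1"] by (simp add: field_simps power2_eq_square)
      ultimately show ?thesis
        by (simp add: X2)
    qed
    show "continuous_on {1..} (\<lambda>x. - ?G x)"
    proof (rule continuous_on_subset[of "{0<..}"])
      show "continuous_on {0<..} (\<lambda>x. - ?G x)"
        unfolding w_def
        by (intro continuous_intros continuous_on_subset[OF v_cont] continuous_on_subset[OF V_cont])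
          (use V_pos m in force)+
    qed auto
  qed
  have "?G r \<ge> r" if "r \<ge> 1" for r
    using C w_pos[of r] that m by (simp add: add.assoc)
  \<comment> \<open>The radius \<open>?G 1 + 1\<close> is at least \<open>1\<close>; there
    \<open>?G\<close> would be at least \<open>?G 1 + 1\<close> but at most
    \<open>?G 1\<close>.\<close>
  from this[of 1] this[of "?G 1 + 1"] G[of "?G 1 + 1"] show False
    by linarith
qed

text \<open>The flux \<open>A\<close> may grow with \<open>r\<close>, so decay of \<open>u\<close>
  alone is not enough. Split \<open>u r = (u r - u t) + u t\<close>: the oscillation estimate bounds
  \<open>A (u r - u t)\<close> by a tail of \<open>F\<close>, uniformly in \<open>t\<close>, so
  \<open>t\<close> can be chosen after \<open>A\<close> to make \<open>A u t\<close> small.\<close>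

lemma flux_product_tends_to_zero:
  assumes bdd: "bdd_above (F ` {0..})" and e: "e > 0"
  shows "\<exists>R>0. \<forall>r\<ge>R. - (W r * v1 r) * u r \<le> e"
proof -
  define E where "E = (SUP r\<in>{0..}. F r)"
  have F_le: "F r \<le> E" if "r \<ge> 0" for r
    unfolding E_def by (intro cSUP_upper bdd) (use that in simp)
  obtain R0 where R0: "R0 \<ge> 0" "E - e / 2 < F R0"
    using less_cSUP_iff[OF _ bdd, of "E - e / 2"] e unfolding E_def by auto
  have "- (W r * v1 r) * u r \<le> e" if r: "r \<ge> R0 + 1" for r
  proof -
    define A where "A = - (W r * v1 r)"
    have A: "A > 0"
      using W_pos[of r] v1_neg[of r] r R0 by (simp add: A_def mult_less_0_iff)
    obtain s where s: "s \<ge> 0" "u s < e / 2 / A"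
      using u_tends_to_zero[OF bdd, of "e / 2 / A"] e A by auto
    define t where "t = max r s"
    have "u t \<le> u s"
      using s by (intro u_decreasing) (auto simp: t_def)
    then have "A * u t \<le> A * u s"
      using A by simp
    also have "\<dots> \<le> e / 2"
      using s A by (simp add: field_simps)
    finally have "A * u t \<le> e / 2" .
    moreover have "A * (u r - u t) \<le> F t - F r"
      unfolding A_def using r R0 by (intro flux_oscillation) (auto simp: t_def)
    moreover have "F t \<le> E" "F R0 \<le> F r"
      using r R0 by (auto intro!: F_le F_mono simp: t_def)
    ultimately show ?thesis
      using R0 by (simp add: A_def[symmetric] algebra_simps)
  qed
  then show ?thesis
    using R0 by (intro exI[of _ "R0 + 1"]) auto
qed

section \<open>Simultaneous finiteness of the three integrals\<close>

lemma u_power_primitive: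
  shows "continuous_on {0..} (\<lambda>r. F r - W r * v1 r * u r)"
    and "F 0 - W 0 * v1 0 * u 0 = 0"
    and "r > 0 \<Longrightarrow> ((\<lambda>r. F r - W r * v1 r * u r) has_real_derivative W r * u r powr (p + 1)) (at r)"
proof -
  show "continuous_on {0..} (\<lambda>r. F r - W r * v1 r * u r)"
    by (intro continuous_intros F_cont W_cont v1_cont u_cont)
  show "F 0 - W 0 * v1 0 * u 0 = 0"
    by (simp add: F_0 W_0)
  assume r: "r > 0"
  show "((\<lambda>r. F r - W r * v1 r * u r) has_real_derivative W r * u r powr (p + 1)) (at r)"
    using DERIV_diff[OF F_deriv DERIV_mult[OF v_flux u_deriv]] r u_pos[of r]
    by (simp add: powr_add algebra_simps)
qed

text \<open>The boundary term \<open>-W v1 u\<close> is nonnegative, which gives one direction.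
  Conversely it is at most \<open>1\<close> beyond some \<open>R\<close>, and monotonicity of the
  primitive carries the bound from \<open>max r R\<close> back to \<open>r\<close>.\<close>

lemma bdd_u_power_primitive_iff:
  "bdd_above ((\<lambda>r. F r - W r * v1 r * u r) ` {0..}) \<longleftrightarrow> bdd_above (F ` {0..})"
proof
  assume "bdd_above ((\<lambda>r. F r - W r * v1 r * u r) ` {0..})"
  then obtain M where M: "\<And>r. r \<ge> 0 \<Longrightarrow> F r - W r * v1 r * u r \<le> M"
    by (auto simp: bdd_above_def)
  have "W r * v1 r * u r \<le> 0" if "r \<ge> 0" for r
    using v_flux_mono[of 0 r] that u_pos[OF that] W_0 by (simp add: mult_nonpos_nonneg)
  then have "F r \<le> M" if "r \<ge> 0" for r
    using M[OF that] that by fastforce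
  then show "bdd_above (F ` {0..})"
    by (intro bdd_aboveI2) auto
next
  assume bdd: "bdd_above (F ` {0..})"
  then obtain M where M: "\<And>r. r \<ge> 0 \<Longrightarrow> F r \<le> M"
    by (auto simp: bdd_above_def)
  obtain R where R: "R > 0" "\<And>r. r \<ge> R \<Longrightarrow> - (W r * v1 r) * u r \<le> 1"
    using flux_product_tends_to_zero[OF bdd, of 1] by auto
  have "F r - W r * v1 r * u r \<le> M + 1" if "r \<ge> 0" for r
  proof -
    let ?t = "max r R"
    have "F r - W r * v1 r * u r \<le> F ?t - W ?t * v1 ?t * u ?t"
      using that by (intro nondecreasing_halfline[OF u_power_primitive(1,3)])
        (simp_all add: less_imp_le[OF W_pos])
    also have "\<dots> \<le> M + 1"
      using M[of ?t] R(2)[of ?t] that by (auto simp: le_max_iff_disj)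
    finally show ?thesis .
  qed
  then show "bdd_above ((\<lambda>r. F r - W r * v1 r * u r) ` {0..})"
    by (intro bdd_aboveI2) auto
qed

lemma energy_finite_iff:
  "(\<integral>\<^sup>+ s \<in> {0<..}. ennreal (W s * (u1 s * v1 s)) \<partial>lborel) < \<infinity> \<longleftrightarrow> bdd_above (F ` {0..})"
proof (rule nn_integral_halfline_finite_iff[OF F_cont F_0 F_deriv])
  show "continuous_on {0<..} (\<lambda>s. W s * (u1 s * v1 s))"
    by (rule continuous_on_subset[of "{0..}"])
      (auto intro!: continuous_intros W_cont u1_cont v1_cont)
  show "W r * (u1 r * v1 r) \<ge> 0" if "r > 0" for r
    using that W_pos[of r] u1_neg[of r] v1_neg[of r] by (simp add: mult_nonpos_nonpos less_imp_le)
qed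

lemma u_power_integral_finite_iff:
  "(\<integral>\<^sup>+ s \<in> {0<..}. ennreal (W s * u s powr (p + 1)) \<partial>lborel) < \<infinity> \<longleftrightarrow> bdd_above (F ` {0..})"
  unfolding bdd_u_power_primitive_iff[symmetric]
proof (rule nn_integral_halfline_finite_iff[OF u_power_primitive])
  have "continuous_on {0..} (\<lambda>s. W s * u s powr (p + 1))"
    using u_pos by (intro continuous_intros W_cont u_cont) force
  then show "continuous_on {0<..} (\<lambda>s. W s * u s powr (p + 1))"
    by (rule continuous_on_subset) auto
  show "W r * u r powr (p + 1) \<ge> 0" if "r > 0" for r
    using W_pos[OF that] by simp
qed

section \<open>Pohozaev functional and rigidity\<close>

text \<open>Only the flux \<open>W v1\<close> is known to be differentiable, so \<open>v1\<close> is
  recovered as flux divided by \<open>W\<close>. The result is the expanded radial equation for the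
  second derivative of \<open>v\<close>.\<close>

lemma v1_deriv:
  assumes r: "r > 0" and W1: "(W has_real_derivative W1) (at r)"
  shows "(v1 has_real_derivative - (u r powr p) - W1 / W r * v1 r) (at r)"
proof -
  have "((\<lambda>s. W s * v1 s / W s) has_real_derivative - (u r powr p) - W1 / W r * v1 r) (at r)"
    by (rule DERIV_cong[OF DERIV_divide[OF v_flux[OF r] W1]])
      (use W_pos[OF r] in \<open>simp_all add: field_simps\<close>)
  then show ?thesis
    by (rule has_field_derivative_transform_within_open[where S = "{0<..}"])
      (use r W_pos in force)+
qed

lemma pohozaev_rigidity:
  assumes bdd: "bdd_above (F ` {0..})"
    and W1: "\<And>r. r > 0 \<Longrightarrow> (W has_real_derivative W1 r) (at r)"
    and k: "\<And>r. r > 0 \<Longrightarrow> k * (W r)\<^sup>2 \<le> V r * W1 r"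
    and pq: "1 / (p + 1) + 1 / (q + 1) \<le> 2 * k - 1"
    and r: "r > 0"
  shows "V r * W1 r = k * (W r)\<^sup>2" and "1 / (p + 1) + 1 / (q + 1) = 2 * k - 1"
proof -
  interpret swap: positive_radial_solution W V F v u v1 u1 q p
    by (rule swapped)
  define a b where "a = 1 / (p + 1)" and "b = 1 / (q + 1)"
  have ab: "a > 0" "b > 0" "a * (p + 1) = 1" "b * (q + 1) = 1"
    using p_pos q_pos by (simp_all add: a_def b_def)
  define P where "P = (\<lambda>r. V r * (u1 r * v1 r + a * u r powr (p + 1) + b * v r powr (q + 1))
    + a * (W r * v1 r * u r) + b * (W r * u1 r * v r))"
  \<comment> \<open>The prefactor is positive for \<open>r > 0\<close>, so the sign of
    \<open>P'\<close> is that of the bracket, to which the hypotheses on \<open>k\<close> and on the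
    exponents apply.\<close>
  define P' where "P' = (\<lambda>r. u1 r * v1 r / W r * ((1 + a + b) * (W r)\<^sup>2 - 2 * (V r * W1 r)))"
  have P_deriv: "(P has_real_derivative P' x) (at x)" if x: "x > 0" for x
  proof -
    have "((\<lambda>x. a * u x powr (p + 1)) has_real_derivative u x powr p * u1 x) (at x)"
      using DERIV_cmult[OF DERIV_fun_powr[OF u_deriv[OF x] u_pos[of x], of "p + 1"], of a] x ab
      by (simp add: mult.assoc[symmetric])
    moreover have "((\<lambda>x. b * v x powr (q + 1)) has_real_derivative v x powr q * v1 x) (at x)"
      using DERIV_cmult[OF DERIV_fun_powr[OF v_deriv[OF x] v_pos[of x], of "q + 1"], of b] x ab
      by (simp add: mult.assoc[symmetric])
    ultimately have "(P has_real_derivative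
        W x * (u1 x * v1 x + a * u x powr (p + 1) + b * v x powr (q + 1))
        + V x * ((- (v x powr q) - W1 x / W x * u1 x) * v1 x
                  + u1 x * (- (u x powr p) - W1 x / W x * v1 x)
                  + u x powr p * u1 x + v x powr q * v1 x)
        + a * (- (W x * u x powr p) * u x + W x * v1 x * u1 x)
        + b * (- (W x * v x powr q) * v x + W x * u1 x * v1 x)) (at x)"
      unfolding P_def
      by (rule DERIV_cong[OF DERIV_add[OF DERIV_add[OF
            DERIV_mult[OF V_deriv[OF x] DERIV_add[OF DERIV_add[OF
              DERIV_mult[OF swap.v1_deriv[OF x W1[OF x]] v1_deriv[OF x W1[OF x]]]]]]
            DERIV_cmult[OF DERIV_mult[OF v_flux[OF x] u_deriv[OF x]], of a]]
            DERIV_cmult[OF DERIV_mult[OF u_flux[OF x] v_deriv[OF x]], of b]]])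
        (simp add: algebra_simps)
    moreover have "u x powr (p + 1) = u x powr p * u x" "v x powr (q + 1) = v x powr q * v x"
      using u_pos[of x] v_pos[of x] x by (simp_all add: powr_add)
    ultimately show ?thesis
      using W_pos[OF x] by (simp add: P'_def field_simps power2_eq_square)
  qed
  have P_cont: "continuous_on {0..} P"
    unfolding P_def using u_pos v_pos
    by (intro continuous_intros V_cont W_cont u_cont v_cont u1_cont v1_cont) force+
  have P'_nonpos: "P' x \<le> 0" if x: "x > 0" for x
  proof -
    have "(1 + a + b) * (W x)\<^sup>2 \<le> 2 * k * (W x)\<^sup>2"
      using pq by (intro mult_right_mono) (auto simp: a_def b_def)
    then have "(1 + a + b) * (W x)\<^sup>2 - 2 * (V x * W1 x) \<le> 0"
      using k[OF x] by simp
    moreover have "u1 x * v1 x / W x \<ge> 0"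
      using u1_neg[OF x] v1_neg[OF x] W_pos[OF x] by (simp add: mult_nonpos_nonpos)
    ultimately show ?thesis
      unfolding P'_def by (rule mult_nonneg_nonpos[rotated])
  qed
  have P_mono: "P y \<le> P x" if "0 \<le> x" "x \<le> y" for x y
  proof -
    have "- P x \<le> - P y"
    proof (rule nondecreasing_halfline[OF _ _ _ that])
      show "((\<lambda>x. - P x) has_real_derivative - P' z) (at z)" if "z > 0" for z
        by (intro DERIV_minus P_deriv that)
    qed (use P'_nonpos P_cont in \<open>auto intro!: continuous_intros\<close>)
    then show ?thesis
      by simp
  qed
  have "P x = 0" if x: "x > 0" for x
  proof (rule antisym)
    have "P 0 = 0"
      by (simp add: P_def V_0 W_0)
    then show "P x \<le> 0"
      using P_mono[of 0 x] x by simp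
    \<comment> \<open>At a large radius \<open>R\<close> only the two boundary terms of
      \<open>P\<close> are negative, each at least \<open>-e'\<close> before weighting by
      \<open>a\<close> or \<open>b\<close>; monotonicity of \<open>P\<close> brings the bound back
      to \<open>x\<close>.\<close>
    have "- P x \<le> e" if e: "e > 0" for e
    proof -
      define e' where "e' = e / (a + b)"
      have "e = (a + b) * e'"
        using ab by (simp add: e'_def)
      then have e': "e' > 0" "e = a * e' + b * e'"
        using e ab by (simp add: e'_def, simp only: distrib_right)
      obtain R1 where R1: "\<And>r. r \<ge> R1 \<Longrightarrow> - (W r * v1 r) * u r \<le> e'"
        using flux_product_tends_to_zero[OF bdd e'(1)] by auto
      obtain R2 where R2: "\<And>r. r \<ge> R2 \<Longrightarrow> - (W r * u1 r) * v r \<le> e'"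
        using swap.flux_product_tends_to_zero[OF bdd e'(1)] by auto
      define R where "R = max x (max R1 R2)"
      have R: "R > 0" "R \<ge> x" "R \<ge> R1" "R \<ge> R2"
        using x by (auto simp: R_def)
      have "- P R \<le> a * (- (W R * v1 R) * u R) + b * (- (W R * u1 R) * v R)"
        using R(1) V_pos[OF R(1)] u1_neg[OF R(1)] v1_neg[OF R(1)] ab
        by (simp add: P_def mult_nonpos_nonpos)
      also have "\<dots> \<le> e"
        unfolding e'(2) using R1[OF R(3)] R2[OF R(4)] ab
        by (intro add_mono mult_left_mono) auto
      finally show ?thesis
        using P_mono[of x R] R x by simp
    qed
    then have "- P x \<le> 0"
      by (rule field_le_epsilon[of _ 0, simplified])
    then show "P x \<ge> 0"
      by simp
  qed
  then have "((\<lambda>_. 0) has_real_derivative P' r) (at r)"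
    by (intro has_field_derivative_transform_within_open[OF P_deriv[OF r], of "{0<..}"])
      (use r in auto)
  then have "P' r = 0"
    using DERIV_unique DERIV_const by blast
  moreover have "u1 r * v1 r / W r \<noteq> 0"
    using u1_neg[OF r] v1_neg[OF r] W_pos[OF r] by simp
  ultimately have eq: "(1 + a + b) * (W r)\<^sup>2 = 2 * (V r * W1 r)"
    by (simp add: P'_def)
  have "(1 + a + b) * (W r)\<^sup>2 \<le> 2 * k * (W r)\<^sup>2"
    using pq by (intro mult_right_mono) (auto simp: a_def b_def)
  \<comment> \<open>The chain \<open>(1 + a + b) W^2 \<le> 2 k W^2 \<le> 2 V W1\<close> has equal
    ends by \<open>eq\<close>, so both inequalities are equalities.\<close>
  then have eq2: "(1 + a + b) * (W r)\<^sup>2 = 2 * k * (W r)\<^sup>2"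
    using eq k[OF r] by simp
  show "V r * W1 r = k * (W r)\<^sup>2"
    using eq eq2 by simp
  have "1 + a + b = 2 * k"
    using eq2 W_pos[OF r] by simp
  then show "1 / (p + 1) + 1 / (q + 1) = 2 * k - 1"
    by (simp add: a_def b_def)
qed

end


section \<open>Cartan-Hadamard models\<close>

lemma C1_halfline_E:
  assumes "C1_halfline w"
  obtains w1 where "continuous_on {0..} w" "continuous_on {0..} w1"
    and "\<And>r. r \<ge> 0 \<Longrightarrow> (w has_real_derivative w1 r) (at r within {0..})"
    and "\<And>r. r > 0 \<Longrightarrow> (w has_real_derivative w1 r) (at r)"
    and "\<And>r. r > 0 \<Longrightarrow> deriv w r = w1 r"
proof -
  obtain w1 where w1: "\<And>r. r \<ge> 0 \<Longrightarrow> (w has_real_derivative w1 r) (at r within {0..})"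
    and cont: "continuous_on {0..} w1"
    using assms unfolding C1_halfline_def by blast
  have at: "(w has_real_derivative w1 r) (at r)" if "r > 0" for r
  proof -
    have "at r within {0..} = at r"
      using that by (intro at_within_open_subset[where S = "{0<..}"]) auto
    then show ?thesis
      using w1[of r] that by simp
  qed
  have "continuous_on {0..} w"
    using w1 by (intro DERIV_continuous_on) auto
  with that cont w1 at show ?thesis
    using DERIV_imp_deriv[OF at] by blast
qed

lemma model_function_DERIV:
  assumes "model_function \<psi>" "r > 0"
  shows "((deriv ^^ k) \<psi> has_real_derivative deriv ((deriv ^^ k) \<psi>) r) (at r)"
proof -
  have "(deriv ^^ k) \<psi> differentiable at r within {0<..}"
    using assms unfolding model_function_def differentiable_on_def by auto
  moreover have "at r within {0<..} = at r"
    using assms by (intro at_within_open) auto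
  ultimately show ?thesis
    by (simp add: DERIV_deriv_iff_real_differentiable)
qed

text \<open>As \<open>deriv\<close> is total, the equation alone does not assert that the flux is
  differentiable; that comes from the regularity of \<open>\<psi>\<close> and
  \<open>deriv w\<close>.\<close>

lemma flux_has_derivative:
  assumes \<psi>: "model_function \<psi>" and w: "deriv w C1_differentiable_on {0<..}" and r: "r > 0"
    and eq: "deriv (\<lambda>s. \<psi> s ^ m * deriv w s) r + \<psi> r ^ m * g = 0"
    and w1: "\<And>s. s > 0 \<Longrightarrow> deriv w s = w1 s"
  shows "((\<lambda>s. \<psi> s ^ m * w1 s) has_real_derivative - (\<psi> r ^ m * g)) (at r)"
proof -
  have "(\<psi> has_real_derivative deriv \<psi> r) (at r)"
    using model_function_DERIV[OF \<psi> r, of 0] by simp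
  moreover have "(deriv w has_real_derivative deriv (deriv w) r) (at r)"
    using C1_differentiable_has_deriv[OF w] r by simp
  ultimately obtain D where D: "((\<lambda>s. \<psi> s ^ m * deriv w s) has_real_derivative D) (at r)"
    using DERIV_mult[OF DERIV_power] by blast
  moreover have "D = - (\<psi> r ^ m * g)"
    using eq DERIV_imp_deriv[OF D] by linarith
  ultimately have "((\<lambda>s. \<psi> s ^ m * deriv w s) has_real_derivative - (\<psi> r ^ m * g)) (at r)"
    by simp
  then show ?thesis
    by (rule has_field_derivative_transform_within_open[where S = "{0<..}"]) (use r w1 in auto)
qed

section \<open>Convexity and volume comparison\<close>

lemma convex_deriv_mono:
  fixes f :: "real \<Rightarrow> real"
  assumes f: "convex_on A f" "connected A" and xy: "x \<in> interior A" "y \<in> interior A" "x \<le> y"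
    and d: "(f has_real_derivative d) (at x)" "(f has_real_derivative e) (at y)"
  shows "d \<le> e"
proof (cases "x = y")
  case True
  then show ?thesis
    using DERIV_unique d by blast
next
  case False
  have "f y - f x \<ge> d * (y - x)" "f x - f y \<ge> e * (x - y)"
    using xy interior_subset[of A]
    by (auto intro!: convex_on_imp_above_tangent[OF f] DERIV_subset[OF d(1)] DERIV_subset[OF d(2)])
  then have "d * (y - x) \<le> e * (y - x)"
    by (simp add: algebra_simps)
  then show ?thesis
    using False xy(3) by simp
qed

text \<open>For \<open>s \<le> r\<close> convexity gives
  \<open>deriv \<psi> s \<le> deriv \<psi> r\<close>, so the derivative of \<open>\<psi>^n\<close>
  at \<open>s\<close> is at most \<open>n \<psi>^(n-1)\<close> times the slope frozen at
  \<open>r\<close>; integrate from \<open>0\<close> to \<open>r\<close>.\<close>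

lemma Cartan_Hadamard_volume:
  assumes \<psi>: "Cartan_Hadamard_model \<psi>" and n: "n \<ge> 1"
    and V: "continuous_on {0..} V" "V 0 = 0"
      "\<And>r. r > 0 \<Longrightarrow> (V has_real_derivative \<psi> r ^ (n - 1)) (at r)"
    and r: "r > 0"
  shows "\<psi> r ^ n \<le> real n * (V r * deriv \<psi> r)"
proof -
  have model: "model_function \<psi>" and conv: "convex_on {0..} \<psi>"
    using \<psi> by (auto simp: Cartan_Hadamard_model_def)
  have pos: "\<psi> s > 0" if "s > 0" for s
    using model that by (simp add: model_function_def)
  have d: "(\<psi> has_real_derivative deriv \<psi> s) (at s)" if "s > 0" for s
    using model_function_DERIV[OF model that, of 0] by simp
  have cont: "continuous_on {0..} \<psi>"
    using model C1_halfline_E unfolding model_function_def by metis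
  let ?g = "\<lambda>s. real n * (V s * deriv \<psi> r) - \<psi> s ^ n"
  have "?g 0 \<le> ?g r"
  proof (rule DERIV_nonneg_imp_increasing_open[where f = ?g])
    fix s assume s: "0 < s" "s < r"
    have "(?g has_real_derivative real n * \<psi> s ^ (n - 1) * (deriv \<psi> r - deriv \<psi> s)) (at s)"
      by (rule DERIV_cong[OF DERIV_diff[OF DERIV_cmult[OF DERIV_cmult_right[OF V(3)[OF s(1)]]]
              DERIV_power[OF d[OF s(1)]]]])
        (simp add: algebra_simps)
    moreover have "deriv \<psi> s \<le> deriv \<psi> r"
      using s r by (intro convex_deriv_mono[OF conv _ _ _ _ d d]) auto
    then have "real n * \<psi> s ^ (n - 1) * (deriv \<psi> r - deriv \<psi> s) \<ge> 0"
      using pos[OF s(1)] by simp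
    ultimately show "\<exists>y. (?g has_real_derivative y) (at s) \<and> y \<ge> 0"
      by blast
  next
    show "continuous_on {0..r} ?g"
      by (rule continuous_on_subset[of "{0..}"]) (auto intro!: continuous_intros V cont)
  qed (use r in simp)
  moreover have "\<psi> 0 = 0"
    using model by (simp add: model_function_def)
  ultimately show ?thesis
    using V(2) n by (simp add: power_0_left)
qed

text \<open>Differentiating the equality, the terms \<open>n \<psi>^(n-1) \<psi>'\<close> cancel and
  \<open>n V \<psi>'' = 0\<close> remains. Hence the slope is constant and equals its initial value
  \<open>1\<close>.\<close>

lemma Euclidean_of_volume_equality:
  assumes \<psi>: "model_function \<psi>"
    and V: "\<And>r. r > 0 \<Longrightarrow> V r \<noteq> 0"
      "\<And>r. r > 0 \<Longrightarrow> (V has_real_derivative \<psi> r ^ (n - 1)) (at r)"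
    and n: "n \<ge> 1"
    and eq: "\<And>r. r > 0 \<Longrightarrow> \<psi> r ^ n = real n * (V r * deriv \<psi> r)"
    and r: "r \<ge> 0"
  shows "\<psi> r = r"
proof (cases "r = 0")
  case True
  then show ?thesis
    using \<psi> by (simp add: model_function_def)
next
  case False
  with r have r: "r > 0" by simp
  obtain \<psi>1 where cont: "continuous_on {0..} \<psi>" "continuous_on {0..} \<psi>1"
    and within: "\<And>r. r \<ge> 0 \<Longrightarrow> (\<psi> has_real_derivative \<psi>1 r) (at r within {0..})"
    and d: "\<And>r. r > 0 \<Longrightarrow> (\<psi> has_real_derivative \<psi>1 r) (at r)"
    and deriv: "\<And>r. r > 0 \<Longrightarrow> deriv \<psi> r = \<psi>1 r"
    using \<psi> C1_halfline_E unfolding model_function_def by metis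
  \<comment> \<open>The slope at \<open>0\<close> is one-sided; uniqueness of derivatives within
    \<open>{0..}\<close> identifies the continuous extension \<open>\<psi>1\<close> there.\<close>
  have "(\<psi> has_real_derivative 1) (at 0 within {0..})"
    using \<psi> by (simp add: model_function_def)
  moreover have "at (0::real) within {0..} \<noteq> bot"
    by (simp add: at_within_Ici_at_right)
  ultimately have \<psi>1_0: "\<psi>1 0 = 1"
    using within[of 0] has_field_derivative_unique by fastforce
  have dd: "(\<psi>1 has_real_derivative 0) (at s)" if s: "s > 0" for s
  proof -
    define D where "D = deriv (deriv \<psi>) s"
    have D: "(deriv \<psi> has_real_derivative D) (at s)"
      using model_function_DERIV[OF \<psi> s, of 1] by (simp add: D_def)
    have "((\<lambda>s. real n * (V s * deriv \<psi> s)) has_real_derivative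
        real n * (\<psi> s ^ (n - 1) * deriv \<psi> s + D * V s)) (at s)"
      by (intro DERIV_cmult DERIV_mult V s D)
    then have "((\<lambda>s. \<psi> s ^ n) has_real_derivative
        real n * (\<psi> s ^ (n - 1) * deriv \<psi> s + D * V s)) (at s)"
      by (rule has_field_derivative_transform_within_open[where S = "{0<..}"]) (use s eq in auto)
    moreover have "((\<lambda>s. \<psi> s ^ n) has_real_derivative real n * (\<psi> s ^ (n - 1) * deriv \<psi> s)) (at s)"
      by (rule DERIV_cong[OF DERIV_power[OF d[OF s]]]) (use s deriv in simp)
    ultimately have "D = 0"
      using DERIV_unique V(1)[OF s] n by fastforce
    then show ?thesis
      using has_field_derivative_transform_within_open[OF D, of "{0<..}" \<psi>1] s deriv by simp
  qed
  have \<psi>1: "\<psi>1 s = 1" if "s > 0" for s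
    using DERIV_isconst_end[OF that continuous_on_subset[OF cont(2)] dd] \<psi>1_0 by simp
  have "\<psi> r - r = \<psi> 0 - 0"
  proof (rule DERIV_isconst_end[OF r])
    show "continuous_on {0..r} (\<lambda>s. \<psi> s - s)"
      by (intro continuous_intros continuous_on_subset[OF cont(1)]) auto
    show "((\<lambda>s. \<psi> s - s) has_real_derivative 0) (at s)" if "0 < s" for s
      by (rule DERIV_cong[OF DERIV_diff[OF d[OF that] DERIV_ident]]) (simp add: \<psi>1 that)
  qed
  then show ?thesis
    using \<psi> by (simp add: model_function_def)
qed

section \<open>Rigidity of Cartan-Hadamard models\<close>

theorem theorem1p3:
  fixes n :: nat and \<psi> u v :: "real \<Rightarrow> real" and p q \<xi> \<eta> :: real
  assumes "n \<ge> 3"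
    and "Cartan_Hadamard_model \<psi>"
    and "p > 0" and "q > 0"
    and "1 / (p + 1) + 1 / (q + 1) \<le> (real n - 2) / real n"
    and "\<xi> > 0" and "\<eta> > 0"
    and "globally_positive_solution_CP n \<psi> p q \<xi> \<eta> u v"
    and "energy_integral n \<psi> u v < \<infinity> \<or>
         power_integral n \<psi> (p + 1) u < \<infinity> \<or>
         power_integral n \<psi> (q + 1) v < \<infinity>"
  shows "(\<forall>r\<ge>0. \<psi> r = r) \<and>
         1 / (p + 1) + 1 / (q + 1) = (real n - 2) / real n \<and>
         energy_integral n \<psi> u v + power_integral n \<psi> (p + 1) u
           + power_integral n \<psi> (q + 1) v < \<infinity>"
proof -
  have model: "model_function \<psi>"
    using assms(2) by (simp add: Cartan_Hadamard_model_def)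
  have \<psi>_pos: "\<And>r. r > 0 \<Longrightarrow> \<psi> r > 0" and \<psi>_0: "\<psi> 0 = 0"
    using model by (auto simp: model_function_def)
  have \<psi>_cont: "continuous_on {0..} \<psi>"
    using model C1_halfline_E unfolding model_function_def by metis
  have \<psi>_d: "(\<psi> has_real_derivative deriv \<psi> s) (at s)" if "s > 0" for s
    using model_function_DERIV[OF model that, of 0] by simp
  note sol = assms(8)[unfolded globally_positive_solution_CP_def global_solution_CP_def]
  have pos: "\<And>r. r \<ge> 0 \<Longrightarrow> u r > 0" "\<And>r. r \<ge> 0 \<Longrightarrow> v r > 0"
    using sol by auto
  obtain u1 where u: "continuous_on {0..} u" "continuous_on {0..} u1"
    and du: "\<And>r. r > 0 \<Longrightarrow> (u has_real_derivative u1 r) (at r)"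
    and u1: "\<And>r. r > 0 \<Longrightarrow> deriv u r = u1 r"
    using sol C1_halfline_E by metis
  obtain v1 where v: "continuous_on {0..} v" "continuous_on {0..} v1"
    and dv: "\<And>r. r > 0 \<Longrightarrow> (v has_real_derivative v1 r) (at r)"
    and v1: "\<And>r. r > 0 \<Longrightarrow> deriv v r = v1 r"
    using sol C1_halfline_E by metis
  define W where "W = (\<lambda>s. \<psi> s ^ (n - 1))"
  have W_cont: "continuous_on {0..} W"
    unfolding W_def by (intro continuous_intros \<psi>_cont)
  obtain V where V: "continuous_on {0..} V" "V 0 = 0"
    "\<And>r. r > 0 \<Longrightarrow> (V has_real_derivative W r) (at r)"
    using antiderivative_halfline[OF W_cont] by blast
  have "continuous_on {0..} (\<lambda>r. W r * (u1 r * v1 r))"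
    by (intro continuous_intros W_cont u v)
  then obtain F where F: "continuous_on {0..} F" "F 0 = 0"
    "\<And>r. r > 0 \<Longrightarrow> (F has_real_derivative W r * (u1 r * v1 r)) (at r)"
    using antiderivative_halfline by blast
  have u_flux: "((\<lambda>s. W s * u1 s) has_real_derivative - (W r * v r powr q)) (at r)" if r: "r > 0" for r
  proof -
    have "\<bar>v r\<bar> powr (q - 1) * v r = v r powr q"
      using pos(2)[of r] r by (simp add: powr_diff)
    moreover have "deriv (\<lambda>s. \<psi> s ^ (n - 1) * deriv u s) r
        + \<psi> r ^ (n - 1) * (\<bar>v r\<bar> powr (q - 1) * v r) = 0"
      using sol r by blast
    moreover have "deriv u C1_differentiable_on {0<..}"
      using sol by blast
    ultimately show ?thesis
      unfolding W_def using flux_has_derivative[OF model _ r _ u1] by metis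
  qed
  have v_flux: "((\<lambda>s. W s * v1 s) has_real_derivative - (W r * u r powr p)) (at r)" if r: "r > 0" for r
  proof -
    have "\<bar>u r\<bar> powr (p - 1) * u r = u r powr p"
      using pos(1)[of r] r by (simp add: powr_diff)
    moreover have "deriv (\<lambda>s. \<psi> s ^ (n - 1) * deriv v s) r
        + \<psi> r ^ (n - 1) * (\<bar>u r\<bar> powr (p - 1) * u r) = 0"
      using sol r by blast
    moreover have "deriv v C1_differentiable_on {0<..}"
      using sol by blast
    ultimately show ?thesis
      unfolding W_def using flux_has_derivative[OF model _ r _ v1] by metis
  qed
  interpret positive_radial_solution W V F u v u1 v1 p q
    by unfold_locales
      (use W_cont \<psi>_0 \<psi>_pos V F u v pos du dv u_flux v_flux assms in \<open>auto simp: W_def\<close>)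
  interpret swap: positive_radial_solution W V F v u v1 u1 q p
    by (rule swapped)
  have "energy_integral n \<psi> u v = (\<integral>\<^sup>+ s \<in> {0<..}. ennreal (W s * (u1 s * v1 s)) \<partial>lborel)"
    unfolding energy_integral_def W_def
    by (intro nn_integral_cong) (auto simp: indicator_def u1 v1 mult_ac)
  then have energy: "energy_integral n \<psi> u v < \<infinity> \<longleftrightarrow> bdd_above (F ` {0..})"
    using energy_finite_iff by simp
  have u_power: "power_integral n \<psi> (p + 1) u < \<infinity> \<longleftrightarrow> bdd_above (F ` {0..})"
    using u_power_integral_finite_iff by (simp add: power_integral_def W_def mult.commute)
  have v_power: "power_integral n \<psi> (q + 1) v < \<infinity> \<longleftrightarrow> bdd_above (F ` {0..})"
    using swap.u_power_integral_finite_iff by (simp add: power_integral_def W_def mult.commute)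
  have bdd: "bdd_above (F ` {0..})"
    using assms(9) unfolding energy u_power v_power by simp
  \<comment> \<open>This is the value of \<open>V W' / W^2\<close> in the Euclidean case
    \<open>W = r^(n-1)\<close>, \<open>V = r^n / n\<close>.\<close>
  define k where "k = (real n - 1) / real n"
  define W1 where "W1 = (\<lambda>r. (real n - 1) * (\<psi> r ^ (n - 2) * deriv \<psi> r))"
  have n: "n > 0" "real n > 1"
    using assms(1) by auto
  have W1: "(W has_real_derivative W1 r) (at r)" if "r > 0" for r
    unfolding W_def W1_def
    by (rule DERIV_cong[OF DERIV_power[OF \<psi>_d[OF that]]])
      (use assms(1) in \<open>simp add: of_nat_diff numeral_2_eq_2\<close>)
  have "(n - 1) * 2 = (n - 2) + n"
    using assms(1) by simp
  then have W2: "(W r)\<^sup>2 = \<psi> r ^ (n - 2) * \<psi> r ^ n" for r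
    unfolding W_def power_mult[symmetric] power_add[symmetric] by simp
  \<comment> \<open>The factorization reduces the hypothesis on \<open>k\<close> to the volume
    comparison and, its prefactor being positive for \<open>r > 0\<close>, also transfers the
    equality case back.\<close>
  have vol: "V r * W1 r - k * (W r)\<^sup>2
      = k * \<psi> r ^ (n - 2) * (real n * (V r * deriv \<psi> r) - \<psi> r ^ n)" for r
    using n by (simp add: W1_def W2 k_def field_simps)
  have k: "k * (W r)\<^sup>2 \<le> V r * W1 r" if r: "r > 0" for r
  proof -
    have "\<psi> r ^ n \<le> real n * (V r * deriv \<psi> r)"
      using n V(3) unfolding W_def by (intro Cartan_Hadamard_volume[OF assms(2) _ V(1,2)] r) auto
    then have "k * \<psi> r ^ (n - 2) * (real n * (V r * deriv \<psi> r) - \<psi> r ^ n) \<ge> 0"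
      using n \<psi>_pos[OF r] by (simp add: k_def)
    then show ?thesis
      using vol[of r] by simp
  qed
  have k2: "2 * k - 1 = (real n - 2) / real n"
    using n by (simp add: k_def field_simps)
  note rigidity = pohozaev_rigidity[OF bdd W1 k, unfolded k2, OF _ _ assms(5)]
  have "\<psi> r ^ n = real n * (V r * deriv \<psi> r)" if r: "r > 0" for r
    using rigidity(1)[OF _ _ r] vol[of r] n \<psi>_pos[OF r] by (simp add: k_def)
  then have "\<forall>r\<ge>0. \<psi> r = r"
    using Euclidean_of_volume_equality[OF model _ V(3)[unfolded W_def]] V_pos n
    by (metis less_irrefl Suc_leI One_nat_def)
  moreover have "1 / (p + 1) + 1 / (q + 1) = (real n - 2) / real n"
    \<comment> \<open>Any positive radius would do: the identity for the exponents does not involve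
      it.\<close>
    using rigidity(2)[of 1] by simp
  ultimately show ?thesis
    using bdd energy u_power v_power by simp
qed

end
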